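(* Let $w\ge 1$ be an integer and let $\mathbf{F}$ be an $N\times M$ uniformly symmetric random fingerprinting matrix with parameter $w$. The collusion attack described in the context succeeds against this fingerprinting system, i.e. the host signal is estimated correctly ($\widehat{\mathbf{s}}=\mathbf{s}$), with probability greater than $1-\delta$ as long as the number of colluders $K$ satisfies $$K\ \ge\ \frac{\log(N/\delta)}{\log\left(1+\frac{1}{2w}\right)}.$$
   Context: Fingerprinting model. $\mathbf{s}\in\mathbb{R}^N$ is a host signal unknown to the users. $\mathbf{F}=[f_{i,j}]$ is an $N\times M$ matrix ($M>N$) with columns $\mathbf{f}_1,\dots,\mathbf{f}_M$ (fingerprints) and entries in a finite alphabet $\Xi\subset\mathbb{R}$. User $m$ receives the copy $\mathbf{q}_m=\mathbf{s}+\mathbf{f}_m$. Uniformly symmetric matrix. $\mathbf{F}$ is uniformly symmetric with parameter $w$ if its entries $f_{i,j}$ are chosen i.i.d. from $\Xi=\{-\frac{w}{z},\dots,-\frac1z,0,\frac1z,\dots,\frac{w}{z}\}$, each value having probability $\frac{1}{2w+1}$, where $z>0$ is the normalization factor for which $\mathbb{E}\|\mathbf{f}_m\|_2^2=1$. Collusion attack. The colluders are, without loss of generality, users $1,\dots,K$; they know $\Xi$, the distribution of the entries, and their copies $\mathbf{q}_1,\dots,\mathbf{q}_K$. Let $\mathcal{U}$ be the set of $u\in\mathbb{R}$ for which there is exactly one ordered pair $(\xi,\xi')\in\Xi\times\Xi$ with $u=\xi-\xi'$. For each row $i$ they compute $\mathbf{a}_i=(a_{i,1},\dots,a_{i,K})$,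 where $a_{i,j}=f_{i,1}-f_{i,j}$ is the $i$th coordinate of $\mathbf{q}_1-\mathbf{q}_j$, and $\mathcal{A}_i=\{a_{i,j}-a_{i,k}:\ 1\le j,k\le K\}$. If some $a_{i,j}-a_{i,k}=f_{i,k}-f_{i,j}$ lies in $\mathcal{U}$, then $(f_{i,k},f_{i,j})$ is uniquely determined and they obtain $f_{i,1}=a_{i,j}+f_{i,j}$ exactly. If $\mathcal{A}_i\cap\mathcal{U}=\emptyset$, they estimate $f_{i,1}$ by the first component of a maximizer of $p(\mathbf{b})=\prod_{k=1}^K p_{b_k}$ (with $p_\xi=P(f_{i,j}=\xi)$) over $$\mathcal{B}(\mathbf{a}_i)=\{\mathbf{b}=(b_1,\dots,b_K)\in\Xi^K:\ b_1-b_j=a_{i,j},\ j=1,\dots,K\};$$ if there are several maximizers, one of them is chosen arbitrarily. With $\widehat f_{i,1}$ the resulting value, the estimate of the host signal is $\widehat s_i=q_{i,1}-\widehat f_{i,1}$, $i=1,\dots,N$, where $q_{i,1}$ is the $i$th coordinate of $\mathbf{q}_1$.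
   Formalization: If N=1 and K equals the bound exactly, the success probability is shown to equal 1-δ (the strict claim fails there, e.g. w=K=1, δ=2/3); otherwise it exceeds 1-δ. Arbitrary choices in row i may depend only on i and a_i, since choices depending on the hidden fingerprints can break the claim. *)

theory Defs
  imports "HOL-Probability.Probability"
begin

definition alphabet :: "nat \<Rightarrow> real \<Rightarrow> real set" where
  "alphabet w z = (\<lambda>k. real_of_int k / z) ` {- int w..int w}"

text \<open>
  Rows and users are numbered from 1, and \<open>F i j\<close> is the random entry in row \<open>i\<close> of the
  fingerprint of user \<open>j\<close>. Independence over \<open>count_space (alphabet w z)\<close> includes that the
  entries are random variables with values in the alphabet. The last clause determines \<open>z\<close>.
\<close>

definition uniformly_symmetric ::
  "'a measure \<Rightarrow> nat \<Rightarrow> real \<Rightarrow> nat \<Rightarrow> nat \<Rightarrow> (nat \<Rightarrow> nat \<Rightarrow> 'a \<Rightarrow> real) \<Rightarrow> bool" where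
  "uniformly_symmetric P w z N M F \<longleftrightarrow>
     prob_space P \<and> z > 0 \<and>
     prob_space.indep_vars P (\<lambda>_. count_space (alphabet w z)) (\<lambda>(i, j). F i j)
       ({1..N} \<times> {1..M}) \<and>
     (\<forall>i\<in>{1..N}. \<forall>j\<in>{1..M}. \<forall>\<xi>\<in>alphabet w z.
        measure P {\<omega> \<in> space P. F i j \<omega> = \<xi>} = 1 / (2 * real w + 1)) \<and>
     (\<forall>j\<in>{1..M}. integral\<^sup>L P (\<lambda>\<omega>. \<Sum>i=1..N. (F i j \<omega>)\<^sup>2) = 1)"

text \<open>The entries are identically distributed, so the first one stands for all of them.\<close>

definition entry_prob :: "'a measure \<Rightarrow> (nat \<Rightarrow> nat \<Rightarrow> 'a \<Rightarrow> real) \<Rightarrow> real \<Rightarrow> real" where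
  "entry_prob P F \<xi> = measure P {\<omega> \<in> space P. F 1 1 \<omega> = \<xi>}"

definition copies ::
  "(nat \<Rightarrow> real) \<Rightarrow> (nat \<Rightarrow> nat \<Rightarrow> 'a \<Rightarrow> real) \<Rightarrow> 'a \<Rightarrow> nat \<Rightarrow> nat \<Rightarrow> real" where
  "copies s F \<omega> m i = s i + F i m \<omega>"

definition unique_differences :: "real set \<Rightarrow> real set" where
  "unique_differences \<Xi> = {u. \<exists>!p. p \<in> \<Xi> \<times> \<Xi> \<and> u = fst p - snd p}"

text \<open>
  The vector \<open>(a\<^sub>i\<^sub>,\<^sub>1, \<dots>, a\<^sub>i\<^sub>,\<^sub>K)\<close>. It is restricted to the indices of the colluders, so that a
  function of it cannot use the copies of the other users.
\<close>

definition row_differences :: "nat \<Rightarrow> (nat \<Rightarrow> nat \<Rightarrow> real) \<Rightarrow> nat \<Rightarrow> nat \<Rightarrow> real" where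
  "row_differences K q i = (\<lambda>j\<in>{1..K}. q 1 i - q j i)"

definition difference_set :: "nat \<Rightarrow> (nat \<Rightarrow> real) \<Rightarrow> real set" where
  "difference_set K a = {a j - a k | j k. j \<in> {1..K} \<and> k \<in> {1..K}}"

definition candidates :: "nat \<Rightarrow> real set \<Rightarrow> (nat \<Rightarrow> real) \<Rightarrow> (nat \<Rightarrow> real) set" where
  "candidates K \<Xi> a = {b \<in> {1..K} \<rightarrow>\<^sub>E \<Xi>. \<forall>j\<in>{1..K}. b 1 - b j = a j}"

definition likelihood :: "nat \<Rightarrow> (real \<Rightarrow> real) \<Rightarrow> (nat \<Rightarrow> real) \<Rightarrow> real" where
  "likelihood K p b = (\<Prod>k=1..K. p (b k))"

text \<open>
  All values of the estimate of \<open>f\<^sub>i\<^sub>,\<^sub>1\<close> that the attack may return on the differences \<open>a\<close>. In the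
  first case \<open>(\<xi>, \<xi>')\<close> is the pair \<open>(f\<^sub>i\<^sub>,\<^sub>k, f\<^sub>i\<^sub>,\<^sub>j)\<close>, uniquely determined by \<open>a j - a k\<close>.
\<close>

definition row_estimates ::
  "nat \<Rightarrow> real set \<Rightarrow> (real \<Rightarrow> real) \<Rightarrow> (nat \<Rightarrow> real) \<Rightarrow> real set" where
  "row_estimates K \<Xi> p a =
     (if difference_set K a \<inter> unique_differences \<Xi> \<noteq> {}
      then {a j + \<xi>' | j k \<xi> \<xi>'. j \<in> {1..K} \<and> k \<in> {1..K} \<and> a j - a k \<in> unique_differences \<Xi> \<and>
              \<xi> \<in> \<Xi> \<and> \<xi>' \<in> \<Xi> \<and> a j - a k = \<xi> - \<xi>'}
      else {b 1 | b. is_arg_max (likelihood K p) (\<lambda>b. b \<in> candidates K \<Xi> a) b})"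

text \<open>
  An instance \<open>est\<close> of the attack fixes all arbitrary choices: in row \<open>i\<close> with differences \<open>a\<close> it
  returns \<open>est i a\<close>. The choices may vary with the row, but they see the copies only through the
  differences: a choice that depended on the copies themselves could, for a fixed host signal,
  depend on the hidden fingerprints. Differences that no matrix over \<open>\<Xi>\<close> produces may admit no
  estimate, and then \<open>est i a\<close> is unconstrained.
\<close>

definition collusion_attack ::
  "nat \<Rightarrow> real set \<Rightarrow> (real \<Rightarrow> real) \<Rightarrow> (nat \<Rightarrow> (nat \<Rightarrow> real) \<Rightarrow> real) \<Rightarrow> bool" where
  "collusion_attack K \<Xi> p est \<longleftrightarrow>
     (\<forall>i a. row_estimates K \<Xi> p a \<noteq> {} \<longrightarrow> est i a \<in> row_estimates K \<Xi> p a)"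

definition host_estimate ::
  "nat \<Rightarrow> (nat \<Rightarrow> (nat \<Rightarrow> real) \<Rightarrow> real) \<Rightarrow> (nat \<Rightarrow> nat \<Rightarrow> real) \<Rightarrow> nat \<Rightarrow> real" where
  "host_estimate K est q i = q 1 i - est i (row_differences K q i)"

definition success_prob ::
  "'a measure \<Rightarrow> nat \<Rightarrow> nat \<Rightarrow> (nat \<Rightarrow> nat \<Rightarrow> 'a \<Rightarrow> real) \<Rightarrow> (nat \<Rightarrow> real) \<Rightarrow>
     (nat \<Rightarrow> (nat \<Rightarrow> real) \<Rightarrow> real) \<Rightarrow> real" where
  "success_prob P N K F s est =
     measure P {\<omega> \<in> space P. \<forall>i\<in>{1..N}. host_estimate K est (copies s F \<omega>) i = s i}"

end

theory Submission
  imports Defs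
begin

text \<open>
  Whichever case of the attack applies and however ties are broken, the estimate in a row is the
  first component of some candidate. Every difference vector \<open>a\<close> that occurs therefore has exactly
  one preimage on which the row estimate is correct, namely the candidate with first component
  \<open>est i a\<close>. Each class of rows with the same differences also contains exactly one row in which
  the least symbol \<open>-w/z\<close> occurs, so there are \<open>(2 w + 1)^K - (2 w)^K\<close> correctly estimated rows
  among \<open>(2 w + 1)^K\<close> equally likely ones. Since the rows are independent, the success probability
  is exactly \<open>(1 - x)^N\<close> with \<open>x = (2 w / (2 w + 1))^K\<close>. The hypothesis on \<open>K\<close> says that
  \<open>N x \<le> \<delta>\<close>, and Bernoulli's inequality, strict for \<open>N \<ge> 2\<close>, concludes.
\<close>

section \<open>The alphabet and its translations\<close>

lemma finite_alphabet: "finite (alphabet w z)"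
  by (simp add: alphabet_def)

lemma card_alphabet:
  assumes "z > 0"
  shows "card (alphabet w z) = 2 * w + 1"
proof -
  have "inj_on (\<lambda>k. real_of_int k / z) {- int w..int w}"
    using assms by (auto simp: inj_on_def)
  then show ?thesis
    by (simp add: alphabet_def card_image)
qed

lemma alphabet_ge:
  assumes "z > 0" and "x \<in> alphabet w z"
  shows "- real w / z \<le> x"
proof -
  obtain k where k: "k \<in> {- int w..int w}" "x = real_of_int k / z"
    using assms(2) by (auto simp: alphabet_def)
  then have "- real w \<le> real_of_int k"
    by auto
  then show ?thesis
    using k(2) assms(1) by (simp only: divide_right_mono less_imp_le)
qed

lemma least_in_alphabet: "- real w / z \<in> alphabet w z"
  unfolding alphabet_def by (rule image_eqI[of _ _ "- int w"]) auto

text \<open>This serves to translate a row with minimum \<open>y\<close> so that its minimum becomes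
  the least symbol: the numerators of \<open>x\<close> and \<open>y\<close> differ by an integer
  from 0 to \<open>2 * w\<close>, and subtracting \<open>w\<close> leads back into the
  range.\<close>

lemma alphabet_shift:
  assumes "z > 0" and "x \<in> alphabet w z" and "y \<in> alphabet w z" and "y \<le> x"
  shows "x - y - real w / z \<in> alphabet w z"
proof -
  obtain k where k: "k \<in> {- int w..int w}" "x = real_of_int k / z"
    using assms(2) by (auto simp: alphabet_def)
  obtain l where l: "l \<in> {- int w..int w}" "y = real_of_int l / z"
    using assms(3) by (auto simp: alphabet_def)
  have "l \<le> k"
    using assms(1,4) k(2) l(2) by (simp add: divide_le_cancel)
  then have "k - l - int w \<in> {- int w..int w}"
    using k(1) l(1) by auto
  moreover have "x - y - real w / z = real_of_int (k - l - int w) / z"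
    using k(2) l(2) by (simp add: diff_divide_distrib)
  ultimately show ?thesis
    unfolding alphabet_def by (rule rev_image_eqI)
qed

section \<open>Difference vectors and the estimates drawn from them\<close>

definition vec_differences :: "nat \<Rightarrow> (nat \<Rightarrow> real) \<Rightarrow> nat \<Rightarrow> real" where
  "vec_differences K b = (\<lambda>j\<in>{1..K}. b 1 - b j)"

lemma row_differences_copies:
  assumes "1 \<le> K" and "\<And>j. j \<in> {1..K} \<Longrightarrow> F i j \<omega> = b j"
  shows "row_differences K (copies s F \<omega>) i = vec_differences K b"
  using assms by (auto simp: row_differences_def vec_differences_def copies_def)

text \<open>A maximizer exists because the candidates are finitely many and include
  \<open>b\<close>. In the other case uniqueness forces every decoded pair to be the true one, so
  each estimate is \<open>b 1\<close>.\<close>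

lemma row_estimates_vec_differences:
  assumes "1 \<le> K" and "finite \<Xi>" and "b \<in> {1..K} \<rightarrow>\<^sub>E \<Xi>"
  shows "row_estimates K \<Xi> p (vec_differences K b) \<noteq> {}"
    and "row_estimates K \<Xi> p (vec_differences K b) \<subseteq>
           (\<lambda>c. c 1) ` candidates K \<Xi> (vec_differences K b)"
proof -
  let ?a = "vec_differences K b"
  let ?C = "candidates K \<Xi> ?a"
  have b: "b \<in> ?C"
    using assms(3) by (simp add: candidates_def vec_differences_def)
  have a: "?a j = b 1 - b j" if "j \<in> {1..K}" for j
    using that by (simp add: vec_differences_def)
  have bin: "b j \<in> \<Xi>" if "j \<in> {1..K}" for j
    using that assms(3) by auto
  have "row_estimates K \<Xi> p ?a \<noteq> {} \<and> row_estimates K \<Xi> p ?a \<subseteq> (\<lambda>c. c 1) ` ?C"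
  proof (cases "difference_set K ?a \<inter> unique_differences \<Xi> = {}")
    case True
    have fin: "finite ?C"
      by (rule finite_subset[of _ "{1..K} \<rightarrow>\<^sub>E \<Xi>"])
        (use assms(2) in \<open>auto simp: candidates_def intro!: finite_PiE\<close>)
    have "Max (likelihood K p ` ?C) \<in> likelihood K p ` ?C"
      using fin b by (intro Max_in) auto
    then obtain c where c: "c \<in> ?C" "likelihood K p c = Max (likelihood K p ` ?C)"
      by force
    then have "is_arg_max (likelihood K p) (\<lambda>b. b \<in> ?C) c"
      using fin by (simp add: is_arg_max_linorder)
    then show ?thesis
      using True by (auto simp: row_estimates_def is_arg_max_def)
  next
    case False
    then obtain j k where jk: "j \<in> {1..K}" "k \<in> {1..K}" "?a j - ?a k \<in> unique_differences \<Xi>"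
      by (auto simp: difference_set_def)
    have "?a j - ?a k = b k - b j"
      using jk by (simp add: a)
    \<comment> \<open>The order of the indices flips: the pair decoded from
      \<open>?a j - ?a k\<close> is \<open>(b k, b j)\<close>, and its second entry restores
      \<open>b 1\<close>.\<close>
    then have "?a j + b j \<in> row_estimates K \<Xi> p ?a"
      using jk bin unfolding row_estimates_def if_P[OF False]
      by (intro CollectI exI[of _ j] exI[of _ k] exI[of _ "b k"] exI[of _ "b j"]) simp
    moreover have "x = b 1" if "x \<in> row_estimates K \<Xi> p ?a" for x
    proof -
      from that obtain j k \<xi> \<xi>' where *: "x = ?a j + \<xi>'" "j \<in> {1..K}" "k \<in> {1..K}"
        "?a j - ?a k \<in> unique_differences \<Xi>" "\<xi> \<in> \<Xi>" "\<xi>' \<in> \<Xi>" "?a j - ?a k = \<xi> - \<xi>'"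
        unfolding row_estimates_def if_P[OF False] by blast
      have 1: "(\<xi>, \<xi>') \<in> \<Xi> \<times> \<Xi> \<and> ?a j - ?a k = fst (\<xi>, \<xi>') - snd (\<xi>, \<xi>')"
        using * by simp
      have 2: "(b k, b j) \<in> \<Xi> \<times> \<Xi> \<and> ?a j - ?a k = fst (b k, b j) - snd (b k, b j)"
        using *(2,3) bin by (simp add: a)
      have "\<exists>!p. p \<in> \<Xi> \<times> \<Xi> \<and> ?a j - ?a k = fst p - snd p"
        using *(4) by (simp only: unique_differences_def mem_Collect_eq)
      then have "(\<xi>, \<xi>') = (b k, b j)"
        using 1 2 by blast
      then show ?thesis
        using *(1,2) by (simp add: a)
    qed
    ultimately show ?thesis
      using b by blast
  qed
  then show "row_estimates K \<Xi> p ?a \<noteq> {}" and "row_estimates K \<Xi> p ?a \<subseteq> (\<lambda>c. c 1) ` ?C"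
    by auto
qed

lemma candidates_vec_differences:
  assumes "c \<in> candidates K \<Xi> (vec_differences K b)"
  shows "vec_differences K c = vec_differences K b"
  using assms by (auto simp: candidates_def vec_differences_def)

lemma eq_if_vec_differences_eq:
  assumes "b \<in> {1..K} \<rightarrow>\<^sub>E \<Xi>" and "c \<in> {1..K} \<rightarrow>\<^sub>E \<Xi>"
    and "vec_differences K b = vec_differences K c" and "b 1 = c 1"
  shows "b = c"
proof (rule PiE_ext[OF assms(1,2)])
  fix j
  assume "j \<in> {1..K}"
  then show "b j = c j"
    using fun_cong[OF assms(3), of j] assms(4) by (simp add: vec_differences_def)
qed

section \<open>Counting the correctly estimated rows\<close>

definition correct_rows ::
  "nat \<Rightarrow> real set \<Rightarrow> ((nat \<Rightarrow> real) \<Rightarrow> real) \<Rightarrow> (nat \<Rightarrow> real) set" where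
  "correct_rows K \<Xi> e = {b \<in> {1..K} \<rightarrow>\<^sub>E \<Xi>. e (vec_differences K b) = b 1}"

text \<open>Nonemptiness of \<open>row_estimates\<close> binds \<open>est i a\<close> to the first
  component of some candidate. That candidate has differences \<open>a\<close>, so it is itself
  estimated correctly. Injectivity holds because the differences and the first component determine a
  row.\<close>

lemma bij_betw_correct_rows:
  assumes "1 \<le> K" and "finite \<Xi>" and "collusion_attack K \<Xi> p est"
  shows "bij_betw (vec_differences K) (correct_rows K \<Xi> (est i))
           (vec_differences K ` ({1..K} \<rightarrow>\<^sub>E \<Xi>))"
proof (rule bij_betw_imageI)
  show "inj_on (vec_differences K) (correct_rows K \<Xi> (est i))"
    by (rule inj_onI) (metis (mono_tags, lifting) correct_rows_def eq_if_vec_differences_eq mem_Collect_eq)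
  have "vec_differences K b \<in> vec_differences K ` correct_rows K \<Xi> (est i)"
    if b: "b \<in> {1..K} \<rightarrow>\<^sub>E \<Xi>" for b
  proof -
    let ?a = "vec_differences K b"
    have "est i ?a \<in> row_estimates K \<Xi> p ?a"
      using assms(3) row_estimates_vec_differences(1)[OF assms(1,2) b]
      by (simp add: collusion_attack_def)
    then obtain c where c: "c \<in> candidates K \<Xi> ?a" "est i ?a = c 1"
      using row_estimates_vec_differences(2)[OF assms(1,2) b] by blast
    then have "c \<in> correct_rows K \<Xi> (est i)"
      using candidates_vec_differences[OF c(1)] by (simp add: correct_rows_def candidates_def)
    then show ?thesis
      using candidates_vec_differences[OF c(1)] by (metis image_eqI)
  qed
  then show "vec_differences K ` correct_rows K \<Xi> (est i) = vec_differences K ` ({1..K} \<rightarrow>\<^sub>E \<Xi>)"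
    by (auto simp: correct_rows_def)
qed

text \<open>Rows with equal differences are translates of each other, and exactly one translate has
  its minimum at the bottom of the alphabet.\<close>

lemma bij_betw_rows_with_least:
  assumes "1 \<le> K" and "z > 0"
  shows "bij_betw (vec_differences K)
           (({1..K} \<rightarrow>\<^sub>E alphabet w z) - ({1..K} \<rightarrow>\<^sub>E alphabet w z - {- real w / z}))
           (vec_differences K ` ({1..K} \<rightarrow>\<^sub>E alphabet w z))"
proof (rule bij_betw_imageI)
  let ?\<Xi> = "alphabet w z" and ?l = "- real w / z"
  let ?L = "({1..K} \<rightarrow>\<^sub>E ?\<Xi>) - ({1..K} \<rightarrow>\<^sub>E ?\<Xi> - {?l})"
  have L: "b \<in> ?L \<longleftrightarrow> b \<in> {1..K} \<rightarrow>\<^sub>E ?\<Xi> \<and> (\<exists>j\<in>{1..K}. b j = ?l)" for b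
    by (auto simp: PiE_iff)
  show "inj_on (vec_differences K) ?L"
  proof (rule inj_onI)
    fix b c
    assume b: "b \<in> ?L" and c: "c \<in> ?L" and eq: "vec_differences K b = vec_differences K c"
    \<comment> \<open>Where \<open>b\<close> attains the least symbol, \<open>c\<close> is at least
      as large, and equal differences carry this over to index 1. Generality in \<open>b\<close> and
      \<open>c\<close> allows exchanging them below.\<close>
    have le: "b 1 \<le> c 1"
      if b: "b \<in> ?L" and c: "c \<in> ?L"
        and eq: "vec_differences K b = vec_differences K c" for b c
    proof -
      obtain j where j: "j \<in> {1..K}" "b j = ?l"
        using iffD1[OF L b] by blast
      then have "?l \<le> c j"
        using c by (intro alphabet_ge assms) auto
      moreover have "b 1 - b j = c 1 - c j"
        using fun_cong[OF eq, of j] j(1) by (simp add: vec_differences_def)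
      ultimately show ?thesis
        using j(2) by linarith
    qed
    have "b 1 = c 1"
      using le[OF b c eq] le[OF c b eq[symmetric]] by simp
    then show "b = c"
      using b c eq by (intro eq_if_vec_differences_eq[of b K ?\<Xi> c]) auto
  qed
  have "vec_differences K b \<in> vec_differences K ` ?L" if b: "b \<in> {1..K} \<rightarrow>\<^sub>E ?\<Xi>" for b
  proof -
    have ne: "b ` {1..K} \<noteq> {}"
      using assms(1) by auto
    define m where "m = Min (b ` {1..K})"
    obtain j where j: "j \<in> {1..K}" "m = b j"
      using Min_in[OF _ ne] unfolding m_def by auto
    \<comment> \<open>Translation of \<open>b\<close> that moves its minimum to
      \<open>- real w / z\<close>.\<close>
    define c where "c = (\<lambda>k\<in>{1..K}. b k - m - real w / z)"
    have "c k \<in> ?\<Xi>" if k: "k \<in> {1..K}" for k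
    proof -
      have "m \<le> b k"
        using k by (simp add: m_def)
      then have "b k - m - real w / z \<in> ?\<Xi>"
        using b j k by (intro alphabet_shift assms) auto
      then show ?thesis
        using k by (simp add: c_def)
    qed
    moreover have "c j = ?l"
      using j by (simp add: c_def)
    ultimately have "c \<in> ?L"
      using j(1) unfolding L by (auto simp: c_def)
    moreover have "vec_differences K c = vec_differences K b"
      using assms(1) by (auto simp: vec_differences_def c_def)
    ultimately show ?thesis
      by (metis image_eqI)
  qed
  then show "vec_differences K ` ?L = vec_differences K ` ({1..K} \<rightarrow>\<^sub>E ?\<Xi>)"
    by auto
qed

text \<open>The two bijections share their target, so the difference vectors themselves need not be
  counted.\<close>

lemma card_correct_rows:
  assumes "1 \<le> K" and "z > 0" and "collusion_attack K (alphabet w z) p est"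
  shows "card (correct_rows K (alphabet w z) (est i)) = (2 * w + 1) ^ K - (2 * w) ^ K"
proof -
  let ?\<Xi> = "alphabet w z" and ?l = "- real w / z"
  have "card (correct_rows K ?\<Xi> (est i)) = card (vec_differences K ` ({1..K} \<rightarrow>\<^sub>E ?\<Xi>))"
    using bij_betw_correct_rows[OF assms(1) finite_alphabet assms(3)] by (rule bij_betw_same_card)
  also have "\<dots> = card (({1..K} \<rightarrow>\<^sub>E ?\<Xi>) - ({1..K} \<rightarrow>\<^sub>E ?\<Xi> - {?l}))"
    using bij_betw_rows_with_least[OF assms(1,2)] by (rule bij_betw_same_card[symmetric])
  also have "\<dots> = card ({1..K} \<rightarrow>\<^sub>E ?\<Xi>) - card ({1..K} \<rightarrow>\<^sub>E ?\<Xi> - {?l})"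
    by (rule card_Diff_subset) (auto simp: finite_alphabet intro!: finite_PiE)
  also have "\<dots> = (2 * w + 1) ^ K - (2 * w) ^ K"
    using least_in_alphabet[of w z]
    by (simp add: card_PiE card_alphabet[OF assms(2)] finite_alphabet card_Diff_singleton
        del: minus_divide_left)
  finally show ?thesis .
qed

section \<open>The exact probability of success\<close>

text \<open>The \<open>N * K\<close> entries held by the colluders form equally likely blocks, from
  which the success event is assembled.\<close>

lemma prob_block:
  assumes us: "uniformly_symmetric P w z N M F"
    and "N \<ge> 1" and "1 \<le> K" and "K \<le> M"
    and g: "\<And>i. i \<in> {1..N} \<Longrightarrow> g i \<in> {1..K} \<rightarrow>\<^sub>E alphabet w z"
  shows "{\<omega> \<in> space P. \<forall>i\<in>{1..N}. \<forall>j\<in>{1..K}. F i j \<omega> = g i j} \<in> sets P" (is "?E \<in> _")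
    and "measure P {\<omega> \<in> space P. \<forall>i\<in>{1..N}. \<forall>j\<in>{1..K}. F i j \<omega> = g i j} =
           (1 / (2 * real w + 1)) ^ (N * K)"
proof -
  let ?J = "{1..N} \<times> {1..K}"
  let ?X = "\<lambda>(i, j). F i j"
  interpret prob_space P
    using us by (simp add: uniformly_symmetric_def)
  have indep: "indep_vars (\<lambda>_. count_space (alphabet w z)) ?X ({1..N} \<times> {1..M})"
    using us by (simp add: uniformly_symmetric_def)
  have J: "?J \<noteq> {}" "finite ?J" "?J \<subseteq> {1..N} \<times> {1..M}"
    using assms(2-4) by auto
  \<comment> \<open>A finite intersection of preimages is the shape in which independence of the
    entries applies.\<close>
  have E: "?E = (\<Inter>x\<in>?J. ?X x -` {g (fst x) (snd x)} \<inter> space P)"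
    using J(1) by auto
  have A: "{g (fst x) (snd x)} \<in> sets (count_space (alphabet w z))" if "x \<in> ?J" for x
    using that g[of "fst x"] by (auto dest!: PiE_mem)
  have meas: "?X x -` {g (fst x) (snd x)} \<inter> space P \<in> sets P" if "x \<in> ?J" for x
    using indep that J(3) A[OF that] unfolding indep_vars_def2
    by (intro measurable_sets[of _ P "count_space (alphabet w z)"]) auto
  show "?E \<in> sets P"
    unfolding E using J meas by (intro sets.finite_INT) auto
  have "measure P ?E = (\<Prod>x\<in>?J. measure P (?X x -` {g (fst x) (snd x)} \<inter> space P))"
    unfolding E by (rule indep_varsD[OF indep J A])
  also have "\<dots> = (\<Prod>x\<in>?J. 1 / (2 * real w + 1))"
  proof (rule prod.cong[OF refl])
    fix x
    assume x: "x \<in> ?J"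
    then obtain i j where ij: "x = (i, j)" "i \<in> {1..N}" "j \<in> {1..K}"
      by auto
    have "?X x -` {g (fst x) (snd x)} \<inter> space P = {\<omega> \<in> space P. F i j \<omega> = g i j}"
      using ij by auto
    moreover have "j \<in> {1..M}" "g i j \<in> alphabet w z"
      using ij g[of i] assms(4) by auto
    ultimately show "measure P (?X x -` {g (fst x) (snd x)} \<inter> space P) = 1 / (2 * real w + 1)"
      using us ij(2) by (simp add: uniformly_symmetric_def)
  qed
  also have "\<dots> = (1 / (2 * real w + 1)) ^ (N * K)"
    by simp
  finally show "measure P ?E = (1 / (2 * real w + 1)) ^ (N * K)" .
qed

text \<open>Success is the disjoint union of the blocks whose rows are all correct, so counting them
  gives its probability.\<close>

lemma success_prob_eq:
  assumes us: "uniformly_symmetric P w z N M F"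
    and "N \<ge> 1" and "1 \<le> K" and "K \<le> M"
    and att: "collusion_attack K (alphabet w z) p est"
  shows "success_prob P N K F s est = (1 - (2 * real w / (2 * real w + 1)) ^ K) ^ N"
proof -
  let ?\<Xi> = "alphabet w z"
  interpret prob_space P
    using us by (simp add: uniformly_symmetric_def)
  have z: "z > 0"
    using us by (simp add: uniformly_symmetric_def)
  \<comment> \<open>Correctness is a condition on each row separately, even if \<open>est\<close>
    varies with the row, so the good blocks form a product.\<close>
  define G where "G = Pi\<^sub>E {1..N} (\<lambda>i. correct_rows K ?\<Xi> (est i))"
  define E where "E g = {\<omega> \<in> space P. \<forall>i\<in>{1..N}. \<forall>j\<in>{1..K}. F i j \<omega> = g i j}" for g
  have fin: "finite (correct_rows K ?\<Xi> (est i))" for i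
    by (rule finite_subset[of _ "{1..K} \<rightarrow>\<^sub>E ?\<Xi>"])
      (auto simp: correct_rows_def finite_alphabet intro!: finite_PiE)
  have finG: "finite G"
    unfolding G_def using fin by (intro finite_PiE) auto
  have G: "g i \<in> {1..K} \<rightarrow>\<^sub>E ?\<Xi>" "est i (vec_differences K (g i)) = g i 1"
    if "g \<in> G" "i \<in> {1..N}" for g i
    using that by (auto simp: G_def correct_rows_def PiE_iff)
  \<comment> \<open>Measurability into \<open>count_space\<close> of the alphabet gives membership
    at every point, not just almost surely.\<close>
  have F_in: "F i j \<omega> \<in> ?\<Xi>" if "\<omega> \<in> space P" "i \<in> {1..N}" "j \<in> {1..K}" for \<omega> i j
  proof -
    have "random_variable (count_space ?\<Xi>) (case x of (i, j) \<Rightarrow> F i j)"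
      if "x \<in> {1..N} \<times> {1..M}" for x
      using us that unfolding uniformly_symmetric_def indep_vars_def2 by blast
    from this[of "(i, j)"] have "random_variable (count_space ?\<Xi>) (F i j)"
      using that(2,3) assms(4) by simp
    then show ?thesis
      using measurable_space[OF _ that(1)] by (metis space_count_space)
  qed
  \<comment> \<open>The host signal cancels: it is recovered in row \<open>i\<close> iff the first
    fingerprint entry is.\<close>
  have host: "host_estimate K est (copies s F \<omega>) i = s i \<longleftrightarrow> est i (vec_differences K b) = b 1"
    if "\<And>j. j \<in> {1..K} \<Longrightarrow> F i j \<omega> = b j" for \<omega> i b
    using row_differences_copies[of K F i \<omega> b s, OF assms(3) that] that[of 1] assms(3)
    by (auto simp: host_estimate_def copies_def)
  have "{\<omega> \<in> space P. \<forall>i\<in>{1..N}. host_estimate K est (copies s F \<omega>) i = s i} = \<Union> (E ` G)"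
  proof (intro equalityI subsetI)
    fix \<omega>
    assume \<omega>: "\<omega> \<in> {\<omega> \<in> space P. \<forall>i\<in>{1..N}. host_estimate K est (copies s F \<omega>) i = s i}"
    define g where "g = (\<lambda>i\<in>{1..N}. \<lambda>j\<in>{1..K}. F i j \<omega>)"
    have "g i \<in> correct_rows K ?\<Xi> (est i)" if i: "i \<in> {1..N}" for i
    proof -
      have "est i (vec_differences K (g i)) = g i 1"
        using host[of i \<omega> "g i"] \<omega> i by (auto simp: g_def)
      moreover have "g i \<in> {1..K} \<rightarrow>\<^sub>E ?\<Xi>"
        using \<omega> i F_in by (auto simp: g_def)
      ultimately show ?thesis
        by (simp add: correct_rows_def)
    qed
    then have "g \<in> G"
      by (auto simp: G_def g_def)
    moreover have "\<omega> \<in> E g"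
      using \<omega> by (auto simp: E_def g_def)
    ultimately show "\<omega> \<in> \<Union> (E ` G)"
      by blast
  next
    fix \<omega>
    assume "\<omega> \<in> \<Union> (E ` G)"
    then obtain g where g: "g \<in> G" "\<omega> \<in> E g"
      by blast
    have "host_estimate K est (copies s F \<omega>) i = s i" if "i \<in> {1..N}" for i
      using host[of i \<omega> "g i"] G(2)[OF g(1) that] g(2) that by (auto simp: E_def)
    then show "\<omega> \<in> {\<omega> \<in> space P. \<forall>i\<in>{1..N}. host_estimate K est (copies s F \<omega>) i = s i}"
      using g(2) by (auto simp: E_def)
  qed
  moreover have "disjoint_family_on E G"
    unfolding disjoint_family_on_def
  proof (intro ballI impI)
    fix g h
    assume gh: "g \<in> G" "h \<in> G" "g \<noteq> h"
    show "E g \<inter> E h = {}"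
    proof (rule ccontr)
      assume "E g \<inter> E h \<noteq> {}"
      then obtain \<omega> where \<omega>: "\<omega> \<in> E g" "\<omega> \<in> E h"
        by blast
      have "g i = h i" if "i \<in> {1..N}" for i
        using \<omega> that by (intro PiE_ext[OF G(1)[OF gh(1) that] G(1)[OF gh(2) that]])
          (auto simp: E_def)
      then have "g = h"
        using gh(1,2) unfolding G_def by (intro PiE_ext) auto
      then show False
        using gh(3) by simp
    qed
  qed
  moreover have E_sets: "E ` G \<subseteq> sets P"
    using prob_block(1)[OF us assms(2-4)] G(1) unfolding E_def by blast
  ultimately have "success_prob P N K F s est = (\<Sum>g\<in>G. measure P (E g))"
    unfolding success_prob_def by (simp add: finite_measure_finite_Union[OF finG])
  also have "\<dots> = (\<Sum>g\<in>G. (1 / (2 * real w + 1)) ^ (N * K))"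
    unfolding E_def by (intro sum.cong refl prob_block(2)[OF us assms(2-4)] G(1))
  also have "\<dots> = real (card G) * (1 / (2 * real w + 1)) ^ (N * K)"
    by simp
  also have "card G = ((2 * w + 1) ^ K - (2 * w) ^ K) ^ N"
    unfolding G_def by (simp add: card_PiE card_correct_rows[OF assms(3) z att])
  also have "real \<dots> = ((2 * real w + 1) ^ K - (2 * real w) ^ K) ^ N"
  proof -
    \<comment> \<open>The count is a subtraction of naturals; this inequality rules out
      truncation.\<close>
    have "(2 * w) ^ K \<le> (2 * w + 1) ^ K"
      by (rule power_mono) simp_all
    then show ?thesis
      by (simp only: of_nat_power of_nat_diff of_nat_add of_nat_mult of_nat_numeral of_nat_1)
  qed
  also have "\<dots> * (1 / (2 * real w + 1)) ^ (N * K) =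
      (((2 * real w + 1) ^ K - (2 * real w) ^ K) * (1 / (2 * real w + 1)) ^ K) ^ N"
    by (simp add: power_mult_distrib mult.commute[of N] power_mult)
  also have "((2 * real w + 1) ^ K - (2 * real w) ^ K) * (1 / (2 * real w + 1)) ^ K =
      1 - (2 * real w / (2 * real w + 1)) ^ K"
    by (simp add: power_divide field_simps)
  finally show ?thesis .
qed

section \<open>From the exact probability to the bound on the number of colluders\<close>

text \<open>Strictness enters at \<open>n = 2\<close> through the term \<open>x^2\<close>; for
  \<open>n = 1\<close> both sides agree, which causes the exceptional case of the theorem.\<close>

lemma Bernoulli_strict:
  fixes x :: real
  assumes "0 < x" and "x < 1" and "2 \<le> n"
  shows "1 - real n * x < (1 - x) ^ n"
  using assms(3)
proof (induction n rule: dec_induct)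
  case base
  then show ?case
    using assms(1) by (simp add: power2_eq_square algebra_simps)
next
  case (step n)
  \<comment> \<open>The two sides differ by \<open>n * x^2\<close>.\<close>
  have "1 - real (Suc n) * x \<le> (1 - real n * x) * (1 - x)"
    using assms(1) by (simp add: algebra_simps zero_le_mult_iff)
  also have "\<dots> < (1 - x) ^ n * (1 - x)"
    using step.IH assms(2) by simp
  finally show ?case
    by (simp add: mult.commute)
qed

text \<open>With one row and \<open>K\<close> exactly at the threshold, the success probability
  equals \<open>1 - \<delta>\<close>, so the strict bound fails there and this case is stated apart.
  For \<open>\<delta>\<close> at least \<open>N\<close> the threshold is not positive, hence the
  separate demand for a colluder.\<close>

theorem lemmaV2:
  fixes P :: "'a measure" and F :: "nat \<Rightarrow> nat \<Rightarrow> 'a \<Rightarrow> real" and s :: "nat \<Rightarrow> real"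
    and est :: "nat \<Rightarrow> (nat \<Rightarrow> real) \<Rightarrow> real" and w N M K :: nat and z \<delta> :: real
  assumes "w \<ge> 1" and "N \<ge> 1" and "M > N"
    and "uniformly_symmetric P w z N M F"
    and "1 \<le> K" and "K \<le> M"
    and "collusion_attack K (alphabet w z) (entry_prob P F) est"
    and "\<delta> > 0"
    and "real K \<ge> ln (real N / \<delta>) / ln (1 + 1 / (2 * real w))"
  shows "if N = 1 \<and> real K = ln (real N / \<delta>) / ln (1 + 1 / (2 * real w))
         then success_prob P N K F s est = 1 - \<delta>
         else success_prob P N K F s est > 1 - \<delta>"
proof -
  \<comment> \<open>\<open>r\<close> is the reciprocal of \<open>2 * w / (2 * w + 1)\<close>, which
    turns the logarithmic condition into \<open>r ^ K\<close> being at least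
    \<open>N / \<delta>\<close>.\<close>
  define r where "r = 1 + 1 / (2 * real w)"
  define x where "x = (2 * real w / (2 * real w + 1)) ^ K"
  have succ: "success_prob P N K F s est = (1 - x) ^ N"
    unfolding x_def by (rule success_prob_eq[OF assms(4,2,5,6,7)])
  have r: "r > 1"
    using assms(1) by (simp add: r_def)
  have x_r: "x = 1 / r ^ K"
    using assms(1) by (simp add: x_def r_def field_simps flip: power_divide power_one_over)
  have x: "0 < x" "x < 1"
    using r assms(5) by (simp_all add: x_r one_less_power)
  have ln_rK: "ln (r ^ K) = real K * ln r"
    using r by (simp add: ln_realpow)
  have lr: "ln r > 0"
    using r by simp
  have pos: "real N / \<delta> > 0" "r ^ K > 0"
    using assms(2,8) r by auto
  have le_iff: "ln (real N / \<delta>) / ln r \<le> real K \<longleftrightarrow> real N * x \<le> \<delta>"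
  proof -
    have "ln (real N / \<delta>) / ln r \<le> real K \<longleftrightarrow> ln (real N / \<delta>) \<le> ln (r ^ K)"
      using lr by (simp add: ln_rK pos_divide_le_eq)
    also have "\<dots> \<longleftrightarrow> real N / \<delta> \<le> r ^ K"
      using pos by simp
    also have "\<dots> \<longleftrightarrow> real N * x \<le> \<delta>"
      using pos assms(8) by (simp add: x_r field_simps)
    finally show ?thesis .
  qed
  \<comment> \<open>For \<open>N = 1\<close> the success probability is \<open>1 - x\<close>, so
    equality in the threshold decides between \<open>= 1 - \<delta>\<close> and
    \<open>> 1 - \<delta>\<close>.\<close>
  have eq_iff: "real K = ln (real N / \<delta>) / ln r \<longleftrightarrow> real N * x = \<delta>"
  proof -
    have "real K = ln (real N / \<delta>) / ln r \<longleftrightarrow> ln (real N / \<delta>) = ln (r ^ K)"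
      using lr by (auto simp: ln_rK field_simps)
    also have "\<dots> \<longleftrightarrow> real N / \<delta> = r ^ K"
      using pos by (simp add: ln_inj_iff)
    also have "\<dots> \<longleftrightarrow> real N * x = \<delta>"
      using pos r assms(8) by (auto simp: x_r field_simps)
    finally show ?thesis .
  qed
  have le: "real N * x \<le> \<delta>"
    using assms(9) le_iff by (simp add: r_def)
  show ?thesis
  proof (cases "N = 1")
    case True
    then show ?thesis
      using le eq_iff succ by (auto simp: r_def)
  next
    case False
    then have "1 - real N * x < (1 - x) ^ N"
      using assms(2) x by (intro Bernoulli_strict) auto
    then show ?thesis
      using le False by (simp add: succ)
  qed
qed

end
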